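(* Let $n(r)=\left\lceil\frac{r^2}{1-r^2}\right\rceil$ for $0<r<1$. Then $$\rho_{\mathbb{H}}=\liminf_{r\to1^-}\inf_{f\in\operatorname{Pol}_{n(r)}(\mathbb{C})}\rho_{\mathbb{H},r}(f),\qquad \rho_{\mathbb{H}}^*=\liminf_{r\to1^-}\inf_{f\in\operatorname{Pol}_{n(r)}(\mathbb{C})}\rho_{\mathbb{H},r}^*(f).$$
   Context: Notation: $\mathbb{D}(0,r)=\{z\in\mathbb{C}:|z|<r\}$, $\mathbb{D}=\mathbb{D}(0,1)$, $dA(z)=\frac{dx\,dy}{\pi}$ for $z=x+iy$; $\lceil x\rceil$ is the smallest integer $n$ with $n\ge x$. $\operatorname{Pol}(\mathbb{C})$ is the set of all complex polynomials in one variable, and $\operatorname{Pol}_n(\mathbb{C})$ is the set of those of degree at most $n-1$. For $0<r<1$ and $f$ holomorphic on $\mathbb{D}$ put $$\Phi_f(z,r)=\left((1-|z|^2)|f(z)|-1_{\mathbb{D}(0,r)}(z)\right)^2,\qquad z\in\mathbb{D}.$$ For polynomials $f$ define $$\rho_{\mathbb{H},r}(f)=\frac{1}{\log\frac{1}{1-r^2}}\int_{\mathbb{D}(0,r)}\Phi_f(z,r)\frac{dA(z)}{1-|z|^2},\qquad \rho_{\mathbb{H},r}^*(f)=\frac{1}{\log\frac{1}{1-r^2}}\int_{\mathbb{D}}\Phi_f(z,r)\frac{dA(z)}{1-|z|^2},$$ and $$\rho_{\mathbb{H}}=\liminf_{r\to1^-}\inf_{f\in\operatorname{Pol}(\mathbb{C})}\rho_{\mathbb{H},r}(f),\qquad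 \rho_{\mathbb{H}}^*=\liminf_{r\to1^-}\inf_{f\in\operatorname{Pol}(\mathbb{C})}\rho_{\mathbb{H},r}^*(f).$$ *)

theory Defs
  imports "HOL-Analysis.Analysis" "HOL-Computational_Algebra.Polynomial"
begin

definition Phi :: "(complex \<Rightarrow> complex) \<Rightarrow> complex \<Rightarrow> real \<Rightarrow> real" where
  "Phi f z r = ((1 - (cmod z)\<^sup>2) * cmod (f z) - indicator (ball 0 r) z)\<^sup>2"

text \<open>
  The factor \<open>1 / pi\<close> in the next two definitions comes from the normalised area element
  \<open>dA = dx dy / pi\<close>; \<open>lborel\<close> on \<open>complex\<close> is \<open>dx dy\<close>. For \<open>0 < r < 1\<close> and a polynomial \<open>f\<close>
  both integrands are bounded on the domain of integration (for \<open>r \<le> cmod z < 1\<close> the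
  integrand is \<open>(1 - (cmod z)\<^sup>2) * (cmod (poly f z))\<^sup>2\<close>), so the integrals exist.
\<close>

definition rho_H_at :: "real \<Rightarrow> complex poly \<Rightarrow> real" where
  "rho_H_at r f = 1 / ln (1 / (1 - r\<^sup>2)) *
     (1 / pi * (LINT z:ball 0 r|lborel. Phi (poly f) z r / (1 - (cmod z)\<^sup>2)))"

definition rho_H_star_at :: "real \<Rightarrow> complex poly \<Rightarrow> real" where
  "rho_H_star_at r f = 1 / ln (1 / (1 - r\<^sup>2)) *
     (1 / pi * (LINT z:ball 0 1|lborel. Phi (poly f) z r / (1 - (cmod z)\<^sup>2)))"

text \<open>Infima and lower limits are taken in \<open>ereal\<close>, where they always exist.\<close>

definition rho_H :: ereal where
  "rho_H = Liminf (at_left 1) (\<lambda>r. INF f\<in>(UNIV :: complex poly set). ereal (rho_H_at r f))"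

definition rho_H_star :: ereal where
  "rho_H_star = Liminf (at_left 1) (\<lambda>r. INF f\<in>(UNIV :: complex poly set). ereal (rho_H_star_at r f))"

text \<open>
  Polynomials of degree at most \<open>n - 1\<close>. The zero polynomial is listed separately because
  \<open>degree 0 = 0\<close>; writing \<open>degree f < n\<close> avoids truncated subtraction.
\<close>

definition Pol :: "nat \<Rightarrow> complex poly set" where
  "Pol n = {f. f = 0 \<or> degree f < n}"

definition deg_bound :: "real \<Rightarrow> nat" where
  "deg_bound r = nat \<lceil>r\<^sup>2 / (1 - r\<^sup>2)\<rceil>"

end

theory Submission
  imports Defs "HOL-Real_Asymp.Real_Asymp"
begin

text \<open>
  Since the lower limit only sees a sequence of radii, the radius may be decreased along with the
  degree. Write \<open>L = ln (1 / (1 - r\<^sup>2))\<close> and \<open>w = 1 - \<bar>z\<bar>\<^sup>2\<close>. If \<open>f\<close> is no worse than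
  the zero polynomial, the mass of \<open>w \<bar>f\<bar>\<^sup>2\<close> is at most \<open>4 L\<close>. Among the roughly
  \<open>sqrt L\<close> outermost annuli \<open>4 x \<ge> 1 - \<bar>z\<bar>\<^sup>2 \<ge> x\<close>, where \<open>x = 4 powi - j\<close>, one carries mass
  \<open>O(sqrt L)\<close>; let \<open>R\<close> be its outer radius, so that the corresponding \<open>L\<close> has changed by
  \<open>O(sqrt L)\<close> only. Monomials are orthogonal on discs, and a monomial of degree at least
  \<open>R\<^sup>2 / (1 - R\<^sup>2)\<close> has at least half of its mass in \<open>ball 0 R\<close> on that annulus. Hence the terms of
  \<open>f\<close> of such degree have mass \<open>O(sqrt L)\<close> in \<open>ball 0 R\<close>, and removing them changes the unnormalised
  density by \<open>O(L powr (3/4))\<close>, which is negligible against \<open>L\<close>.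
\<close>

subsection \<open>Rotation invariance and radial integrals\<close>

text \<open>
  The library has the invariance of Lebesgue measure under orthogonal maps only for \<open>real ^ 'n\<close>,
  so the complex plane is identified with \<open>real ^ 2\<close>.
\<close>

lemma distr_lborel_orthogonal:
  fixes f :: "real ^ 'n::{finite,wellorder} \<Rightarrow> real ^ 'n::_"
  assumes f: "orthogonal_transformation f"
  shows "distr lborel borel f = lborel"
proof (rule lborel_eqI[symmetric])
  fix l u :: "real ^ 'n::_"
  assume le: "\<And>b. b \<in> Basis \<Longrightarrow> l \<bullet> b \<le> u \<bullet> b"
  have lin: "linear f" and bij: "bij f"
    using f by (auto simp: orthogonal_transformation_linear orthogonal_transformation_bij)
  have meas: "f \<in> borel_measurable borel"
    using lin by (simp add: borel_measurable_continuous_onI linear_continuous_on linear_conv_bounded_linear)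
  have eq: "f -` box l u = inv f ` box l u"
    using bij by (simp add: bij_vimage_eq_inv_image)
  have inv: "orthogonal_transformation (inv f)"
    using f by (rule orthogonal_transformation_inv)
  have "f -` box l u \<in> sets borel"
    using meas by (metis borel_open measurable_sets_borel open_box)
  then have "measure lborel (f -` box l u) = measure lborel (box l u)"
    using measure_orthogonal_image[OF inv, of "box l u"] by (simp add: eq measure_completion)
  \<comment> \<open>Boundedness makes both sets of finite measure, so the equality of
    \<open>measure\<close> lifts to \<open>emeasure\<close>.\<close>
  moreover have "bounded (f -` box l u)"
    unfolding eq using inv
    by (intro bounded_linear_image bounded_box) (simp_all add: orthogonal_transformation_linear flip: linear_conv_bounded_linear)
  ultimately have "emeasure lborel (f -` box l u) = emeasure lborel (box l u)"
    by (metis bounded_box emeasure_bounded_finite emeasure_eq_ennreal_measure infinity_ennreal_def less_irrefl)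
  then show "emeasure (distr lborel borel f) (box l u) = ennreal (\<Prod>b\<in>Basis. (u - l) \<bullet> b)"
    using meas le by (simp add: emeasure_distr emeasure_lborel_box)
qed simp

section \<open>Transport of Lebesgue measure between \<open>complex\<close> and
  \<open>real ^ 2\<close>\<close>

definition vec_to_complex :: "real ^ 2 \<Rightarrow> complex" where
  "vec_to_complex v = Complex (v $ 1) (v $ 2)"

definition complex_to_vec :: "complex \<Rightarrow> real ^ 2" where
  "complex_to_vec z = vector [Re z, Im z]"

lemma vec_to_complex_inverse: "complex_to_vec (vec_to_complex v) = v"
  by (simp add: vec_to_complex_def complex_to_vec_def vec_eq_iff forall_2)

lemma complex_to_vec_inverse: "vec_to_complex (complex_to_vec z) = z"
  by (simp add: vec_to_complex_def complex_to_vec_def)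

lemma measurable_vec_to_complex: "vec_to_complex \<in> borel_measurable borel"
proof -
  have "continuous_on UNIV vec_to_complex"
    unfolding vec_to_complex_def Complex_eq by (intro continuous_intros)
  then show ?thesis by (rule borel_measurable_continuous_onI)
qed

lemma linear_complex_to_vec: "linear complex_to_vec"
  by (rule linearI) (simp_all add: complex_to_vec_def vec_eq_iff forall_2)

lemma measurable_complex_to_vec: "complex_to_vec \<in> borel_measurable borel"
  by (simp add: borel_measurable_continuous_onI linear_continuous_on linear_complex_to_vec
        flip: linear_conv_bounded_linear)

lemma distr_lborel_vec_to_complex: "distr lborel borel vec_to_complex = lborel"
proof (rule lborel_eqI[symmetric])
  fix l u :: complex
  assume le: "\<And>b. b \<in> Basis \<Longrightarrow> l \<bullet> b \<le> u \<bullet> b"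
  have "Re l \<le> Re u" "Im l \<le> Im u"
    using le[of 1] le[of \<i>] by (auto simp: Basis_complex_def)
  have eq: "vec_to_complex -` box l u = box (complex_to_vec l) (complex_to_vec u)"
    by (auto simp: vec_to_complex_def complex_to_vec_def in_box_complex_iff mem_box_cart forall_2)
  have "emeasure lborel (box (complex_to_vec l) (complex_to_vec u))
      = ennreal (\<Prod>b\<in>Basis. (complex_to_vec u - complex_to_vec l) \<bullet> b)"
  proof (subst emeasure_lborel_box)
    show "complex_to_vec l \<bullet> b \<le> complex_to_vec u \<bullet> b" if b: "b \<in> Basis" for b
    proof -
      obtain i where "b = axis i 1" using b by (auto simp: Basis_vec_def)
      then show ?thesis using \<open>Re l \<le> Re u\<close> \<open>Im l \<le> Im u\<close> exhaust_2[of i]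
        by (auto simp: inner_axis complex_to_vec_def)
    qed
  qed simp
  also have "(\<Prod>b\<in>Basis. (complex_to_vec u - complex_to_vec l) \<bullet> b) = (Re u - Re l) * (Im u - Im l)"
  proof -
    have Basis: "(Basis :: (real ^ 2) set) = {axis 1 1, axis 2 1}"
      by (auto simp: Basis_vec_def UNIV_2)
    show ?thesis
      unfolding Basis by (simp add: complex_to_vec_def axis_eq_axis inner_axis)
  qed
  also have "\<dots> = (\<Prod>b\<in>Basis. (u - l) \<bullet> b)"
    by (simp add: Basis_complex_def)
  finally show "emeasure (distr lborel borel vec_to_complex) (box l u) = ennreal (\<Prod>b\<in>Basis. (u - l) \<bullet> b)"
    using measurable_vec_to_complex by (simp add: emeasure_distr eq)
qed simp

lemma distr_lborel_complex_to_vec: "distr lborel borel complex_to_vec = lborel"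
proof -
  have "distr lborel borel complex_to_vec = distr (distr lborel borel vec_to_complex) borel complex_to_vec"
    by (simp add: distr_lborel_vec_to_complex)
  also have "\<dots> = distr lborel borel (complex_to_vec \<circ> vec_to_complex)"
    using measurable_vec_to_complex measurable_complex_to_vec by (subst distr_distr) auto
  also have "complex_to_vec \<circ> vec_to_complex = (\<lambda>v. v)"
    by (simp add: fun_eq_iff vec_to_complex_inverse)
  also have "distr lborel borel (\<lambda>v::real^2. v) = lborel"
    by (rule distr_id2) simp
  finally show ?thesis .
qed

lemma norm_complex_to_vec: "norm (complex_to_vec z) = cmod z"
  by (simp add: complex_to_vec_def norm_vec_def L2_set_def sum_2 cmod_def)

lemma linear_vec_to_complex: "linear vec_to_complex"
  by (rule linearI) (simp_all add: vec_to_complex_def complex_eq_iff)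

text \<open>Conjugated by the identification with \<open>real ^ 2\<close>, multiplication by
  \<open>c\<close> becomes linear and norm-preserving, hence orthogonal.\<close>

lemma distr_lborel_rotation:
  fixes c :: complex
  assumes "cmod c = 1"
  shows "distr lborel borel ((*) c) = (lborel :: complex measure)"
proof -
  define f where "f = complex_to_vec \<circ> (*) c \<circ> vec_to_complex"
  have meas_c: "(*) c \<in> borel_measurable borel"
    by (intro borel_measurable_continuous_onI continuous_intros)
  have lin: "linear f"
    unfolding f_def
    by (intro linear_compose linear_vec_to_complex linear_complex_to_vec) (simp add: linear_times)
  moreover have "norm (f v) = norm v" for v
    using norm_complex_to_vec[of "vec_to_complex v"] assms
    by (simp add: f_def norm_complex_to_vec norm_mult vec_to_complex_inverse)
  ultimately have orth: "orthogonal_transformation f"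
    by (simp add: orthogonal_transformation)
  have meas_f: "f \<in> borel_measurable borel"
    using lin by (simp add: borel_measurable_continuous_onI linear_continuous_on linear_conv_bounded_linear)
  have "(*) c = vec_to_complex \<circ> (f \<circ> complex_to_vec)"
    by (simp add: f_def fun_eq_iff complex_to_vec_inverse)
  then have "distr lborel borel ((*) c) = distr (distr (distr lborel borel complex_to_vec) borel f) borel vec_to_complex"
    using measurable_vec_to_complex measurable_complex_to_vec meas_f
    by (simp add: distr_distr)
  then show ?thesis
    by (simp add: distr_lborel_complex_to_vec distr_lborel_orthogonal[OF orth] distr_lborel_vec_to_complex)
qed

text \<open>The area of an annulus is linear in the squares of its radii, so the squared modulus is
  uniformly distributed. Comparing the two measures on the half-lines \<open>{x<..}\<close>
  suffices.\<close>

lemma distr_cmod_power2_unit_disc: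
  "distr (restrict_space lborel (ball (0::complex) 1)) borel (\<lambda>z. (cmod z)\<^sup>2)
     = density lborel (\<lambda>t. ennreal (pi * indicator {0<..<1} t))" (is "?M = ?N")
proof (rule measure_eqI_lessThan)
  have meas: "(\<lambda>z. (cmod z)\<^sup>2) \<in> borel_measurable (restrict_space lborel (ball (0::complex) 1))"
    by (intro measurable_restrict_space1) simp
  have M: "emeasure ?M {x<..} = ennreal (pi * (1 - max 0 (min 1 x)))" for x :: real
  proof -
    define s where "s = sqrt (max 0 (min 1 x))"
    have s: "0 \<le> s" "s \<le> 1" "s\<^sup>2 = max 0 (min 1 x)"
      by (auto simp: s_def)
    have "emeasure ?M {x<..} = emeasure lborel ({z. x < (cmod z)\<^sup>2} \<inter> ball 0 1)"
      using meas by (subst emeasure_distr)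
        (auto simp: emeasure_restrict_space space_restrict_space intro!: arg_cong[of _ _ "emeasure lborel"])
    also have "\<dots> = emeasure lborel (ball (0::complex) 1 - cball 0 s) "
    proof (cases "x < 0")
      case True
      then have "s = 0" by (simp add: s_def)
      \<comment> \<open>For negative \<open>x\<close> the two sets differ only by the origin, a null
        set.\<close>
      have *: "{z. x < (cmod z)\<^sup>2} \<inter> ball 0 1 = insert 0 (ball (0::complex) 1 - cball 0 s)"
        using True \<open>s = 0\<close> by (auto intro: less_le_trans)
      have "emeasure lborel (insert 0 (ball (0::complex) 1 - cball 0 s)) = emeasure lborel (ball (0::complex) 1 - cball 0 s)"
        by (intro emeasure_Un_null_set[of _ _ "{0}", simplified]) auto
      then show ?thesis using * by simp
    next
      case False
      have "x < (cmod z)\<^sup>2 \<longleftrightarrow> s < cmod z" if "cmod z < 1" for z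
      proof -
        have "(cmod z)\<^sup>2 < 1" using that by (simp add: power_less_one_iff)
        then have "x < (cmod z)\<^sup>2 \<longleftrightarrow> s\<^sup>2 < (cmod z)\<^sup>2"
          using False s by auto
        also have "\<dots> \<longleftrightarrow> s < cmod z"
          using s(1) by (meson norm_ge_zero not_le power_mono_iff zero_less_numeral)
        finally show ?thesis .
      qed
      then have "{z. x < (cmod z)\<^sup>2} \<inter> ball 0 1 = (ball (0::complex) 1 - cball 0 s)"
        by auto
      then show ?thesis by simp
    qed
    also have "\<dots> = emeasure lborel (ball (0::complex) 1) - emeasure lborel (cball (0::complex) s)"
    proof (cases "s = 1")
      \<comment> \<open>Here the closed disc is not contained in the open one, so
        \<open>emeasure_Diff\<close> does not apply.\<close>
      case True
      then have "ball (0::complex) 1 - cball 0 s = {}" by auto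
      then have "emeasure lborel (ball (0::complex) 1 - cball 0 s) = 0" by (simp only: emeasure_empty)
      with True show ?thesis by (simp add: emeasure_ball emeasure_cball)
    next
      case False
      with s show ?thesis by (intro emeasure_Diff) (auto simp: emeasure_cball)
    qed
    also have "\<dots> = ennreal (pi * (1 - max 0 (min 1 x)))"
      using s by (simp add: emeasure_ball emeasure_cball unit_ball_vol_2 algebra_simps flip: ennreal_minus)
    finally show ?thesis .
  qed
  then show "emeasure ?M {x<..} < \<infinity>" for x by simp
  show "emeasure ?M {x<..} = emeasure ?N {x<..}" for x
  proof -
    have "emeasure ?N {x<..} = (\<integral>\<^sup>+t. ennreal pi * indicator {max 0 (min 1 x)<..<1} t \<partial>lborel)"
      by (subst emeasure_density)
         (auto intro!: nn_integral_cong split: split_indicator simp: ennreal_indicator ennreal_mult')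
    also have "\<dots> = ennreal (pi * (1 - max 0 (min 1 x)))"
      by (subst nn_integral_cmult_indicator) (auto simp: ennreal_mult')
    finally show ?thesis using M by simp
  qed
qed auto

text \<open>The smaller disc is cut out by an indicator depending on the squared modulus only, which
  reduces the claim to the image measure on the unit disc.\<close>

lemma integral_radial_disc:
  fixes F :: "real \<Rightarrow> real"
  assumes [measurable]: "F \<in> borel_measurable borel" and "0 \<le> s" "s \<le> 1"
  shows "(LINT z:ball (0::complex) s|lborel. F ((cmod z)\<^sup>2)) = pi * (LINT t:{0<..<s\<^sup>2}|lborel. F t)"
proof -
  have "(LINT z:ball (0::complex) s|lborel. F ((cmod z)\<^sup>2))
     = (LINT z:ball (0::complex) 1|lborel. indicator {..<s\<^sup>2} ((cmod z)\<^sup>2) * F ((cmod z)\<^sup>2))"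
    using assms unfolding set_lebesgue_integral_def
    by (intro Bochner_Integration.integral_cong) (auto split: split_indicator simp: power_strict_mono dest: power_less_imp_less_base)
  also have "\<dots> = (LINT z|restrict_space lborel (ball (0::complex) 1). indicator {..<s\<^sup>2} ((cmod z)\<^sup>2) * F ((cmod z)\<^sup>2))"
    by (simp add: set_lebesgue_integral_def integral_restrict_space)
  also have "\<dots> = (LINT t|distr (restrict_space lborel (ball (0::complex) 1)) borel (\<lambda>z. (cmod z)\<^sup>2). indicator {..<s\<^sup>2} t * F t)"
    by (subst integral_distr) (auto intro!: measurable_restrict_space1)
  also have "\<dots> = (LINT t|lborel. (pi * indicator {0<..<1} t) *\<^sub>R (indicator {..<s\<^sup>2} t * F t))"
    unfolding distr_cmod_power2_unit_disc by (subst integral_density) auto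
  also have "\<dots> = (LINT t|lborel. pi * (indicator {0<..<s\<^sup>2} t *\<^sub>R F t))"
    using power_le_one[of s 2] assms
    by (intro Bochner_Integration.integral_cong) (auto split: split_indicator)
  also have "\<dots> = pi * (LINT t:{0<..<s\<^sup>2}|lborel. F t)"
    by (simp add: set_lebesgue_integral_def)
  finally show ?thesis .
qed

text \<open>The antiderivative of \<open>(1 - t) * t ^ k\<close> vanishing at 0. With
  \<open>u\<close> the squared radius it is the weighted mass of the monomial of degree
  \<open>k\<close> on a disc.\<close>

definition radial_moment :: "nat \<Rightarrow> real \<Rightarrow> real" where
  "radial_moment k u = u ^ (k + 1) / real (k + 1) - u ^ (k + 2) / real (k + 2)"

lemma radial_moment_0 [simp]: "radial_moment k 0 = 0"
  by (simp add: radial_moment_def)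

lemma radial_moment_deriv: "(radial_moment k has_real_derivative (1 - u) * u ^ k) (at u within A)"
proof -
  have "((\<lambda>u. u ^ (k + 1) / real (k + 1) - u ^ (k + 2) / real (k + 2)) has_real_derivative
     real (k + 1) * u ^ k / real (k + 1) - real (k + 2) * u ^ (k + 1) / real (k + 2)) (at u within A)"
    by (rule derivative_eq_intros refl | simp)+
  moreover have "real (k + 1) * u ^ k / real (k + 1) - real (k + 2) * u ^ (k + 1) / real (k + 2) = (1 - u) * u ^ k"
    by (simp del: of_nat_add of_nat_Suc add: algebra_simps)
  ultimately show ?thesis
    unfolding radial_moment_def[abs_def] by simp
qed

lemma radial_moment_mono:
  assumes "0 \<le> u" "u \<le> v" "v \<le> 1"
  shows "radial_moment k u \<le> radial_moment k v"
  using assms(2)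
proof (rule DERIV_nonneg_imp_nondecreasing)
  show "\<exists>y. (radial_moment k has_real_derivative y) (at x) \<and> 0 \<le> y" if "u \<le> x" "x \<le> v" for x
    using that assms by (intro exI[of _ "(1 - x) * x ^ k"] conjI radial_moment_deriv) auto
qed

lemma radial_moment_nonneg: "0 \<le> u \<Longrightarrow> u \<le> 1 \<Longrightarrow> 0 \<le> radial_moment k u"
  using radial_moment_mono[of 0 u k] by simp

lemma integral_radial_moment:
  assumes "0 \<le> u"
  shows "(LINT t:{0<..<u}|lborel. (1 - t) * t ^ k) = radial_moment k u"
proof -
  have "(LBINT t=ereal 0..ereal u. (1 - t) * t ^ k) = radial_moment k u - radial_moment k 0"
  proof (rule interval_integral_FTC_finite)
    show "continuous_on {min 0 u..max 0 u} (\<lambda>t. (1 - t) * t ^ k)"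
      by (intro continuous_intros)
    show "(radial_moment k has_vector_derivative (1 - x) * x ^ k) (at x within {min 0 u..max 0 u})" for x
      using radial_moment_deriv by (simp add: has_real_derivative_iff_has_vector_derivative)
  qed
  then show ?thesis
    using assms by (simp add: interval_integral_Ioo flip: zero_ereal_def)
qed

lemma integral_inverse_weight:
  fixes u :: real
  assumes "0 \<le> u" "u < 1"
  shows "(LINT t:{0<..<u}|lborel. 1 / (1 - t)) = ln (1 / (1 - u))"
proof -
  have "(LBINT t=ereal 0..ereal u. 1 / (1 - t)) = - ln (1 - u) - (- ln (1 - 0))"
  proof (rule interval_integral_FTC_finite)
    show "continuous_on {min 0 u..max 0 u} (\<lambda>t. 1 / (1 - t))"
      using assms by (intro continuous_intros) auto
    show "((\<lambda>t. - ln (1 - t)) has_vector_derivative 1 / (1 - x)) (at x within {min 0 u..max 0 u})"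
      if "min 0 u \<le> x" "x \<le> max 0 u" for x
      unfolding has_real_derivative_iff_has_vector_derivative[symmetric]
      using that assms by (auto intro!: derivative_eq_intros simp: field_simps)
  qed
  then show ?thesis
    using assms by (simp add: interval_integral_Ioo ln_div flip: zero_ereal_def)
qed

text \<open>The moment is \<open>v ^ (k + 1)\<close> times a factor \<open>B v\<close> affine in
  \<open>v\<close>. Passing from \<open>1 - x\<close> to \<open>1 - 4 * x\<close> shrinks the power
  by a factor 8, since \<open>1 - 4 * x \<le> (1 - x) * (1 - 3 * x)\<close> and
  \<open>(1 - 3 * x) ^ (k + 1) \<le> exp (- 3)\<close>, while \<open>B\<close> grows at most by a
  factor 4.\<close>

lemma radial_moment_decay:
  assumes x: "0 < x" "x \<le> 1 / 4" and k: "1 / x \<le> real (k + 1)"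
  shows "radial_moment k (1 - 4 * x) \<le> radial_moment k (1 - x) / 2"
proof -
  define B where "B v = 1 / real (k + 1) - v / real (k + 2)" for v
  have factor: "radial_moment k v = v ^ (k + 1) * B v" for v
    by (simp add: radial_moment_def B_def algebra_simps)
  have B: "B (1 - 4 * x) \<le> 4 * B (1 - x)" "0 \<le> B (1 - 4 * x)"
    using x by (simp_all add: B_def divide_simps) (simp_all add: algebra_simps)
  have "1 - 4 * x \<le> (1 - x) * (1 - 3 * x)"
    using x by (simp add: algebra_simps)
  then have "(1 - 4 * x) ^ (k + 1) \<le> ((1 - x) * (1 - 3 * x)) ^ (k + 1)"
    using x by (intro power_mono) auto
  also have "\<dots> = (1 - x) ^ (k + 1) * (1 - 3 * x) ^ (k + 1)"
    by (rule power_mult_distrib)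
  also have "(1 - 3 * x) ^ (k + 1) \<le> exp (- 3 * x) ^ (k + 1)"
    using x exp_ge_add_one_self[of "- 3 * x"] by (intro power_mono) auto
  also have "\<dots> = exp (real (k + 1) * (- 3 * x))"
    by (rule exp_of_nat_mult[symmetric])
  also have "\<dots> \<le> exp (- 3)"
    using k x by (simp add: field_simps)
  also have "exp (- 3 :: real) \<le> 1 / 8"
  proof -
    have "(2::real) ^ 3 \<le> exp 1 ^ 3"
      using exp_ge_add_one_self[of 1] by (intro power_mono) auto
    also have "\<dots> = exp (3 :: real)"
      using exp_of_nat_mult[of 3 "1 :: real"] by simp
    finally show ?thesis by (simp add: exp_minus field_simps)
  qed
  finally have P: "(1 - 4 * x) ^ (k + 1) \<le> (1 - x) ^ (k + 1) / 8"
    using x by (simp add: mult_left_mono)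
  have "(1 - 4 * x) ^ (k + 1) * B (1 - 4 * x) \<le> (1 - x) ^ (k + 1) / 8 * (4 * B (1 - x))"
    using x B P by (intro mult_mono) auto
  then show ?thesis by (simp add: factor mult_ac)
qed

subsection \<open>Integrals over discs\<close>

definition disc_integral :: "real \<Rightarrow> (complex \<Rightarrow> real) \<Rightarrow> real" where
  "disc_integral s F = (LINT z:ball 0 s|lborel. F z) / pi"

lemma set_integrable_ball_continuous:
  fixes F :: "complex \<Rightarrow> 'b::{banach, second_countable_topology}"
  assumes "continuous_on (cball 0 s) F"
  shows "set_integrable lborel (ball 0 s) F"
proof (rule set_integrable_subset)
  show "set_integrable lborel (cball 0 s) F"
    using assms unfolding set_integrable_def by (intro borel_integrable_compact) auto
qed auto

text \<open>A suitable rotation turns the integrand into its negative and preserves Lebesgue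
  measure, so the integral equals its own negative.\<close>

lemma integral_monomials_orthogonal:
  assumes "j \<noteq> k"
  shows "(LINT z:ball (0::complex) s|lborel. of_real (1 - (cmod z)\<^sup>2) * (z ^ j * cnj z ^ k)) = 0"
proof -
  define G where "G z = indicator (ball (0::complex) s) z *\<^sub>R (of_real (1 - (cmod z)\<^sup>2) * (z ^ j * cnj z ^ k))" for z
  \<comment> \<open>This angle gives \<open>c ^ j * cnj c ^ k = cis pi\<close>, whichever of
    \<open>j\<close> and \<open>k\<close> is larger.\<close>
  define c where "c = cis (pi / (real j - real k))"
  have c: "cmod c = 1" by (simp add: c_def)
  have "c ^ j * cnj c ^ k = cis (real j * (pi / (real j - real k)) - real k * (pi / (real j - real k)))"
    by (simp add: c_def cis_cnj Complex.DeMoivre cis_mult diff_divide_distrib)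
  also have "real j * (pi / (real j - real k)) - real k * (pi / (real j - real k)) = pi"
  proof -
    have "real j * (pi / (real j - real k)) - real k * (pi / (real j - real k))
        = (real j - real k) * (pi / (real j - real k))"
      by (rule left_diff_distrib[symmetric])
    then show ?thesis using assms by simp
  qed
  finally have cjk: "c ^ j * cnj c ^ k = - 1" by simp
  have "G (c * z) = - G z" for z
  proof -
    have "(c * z) ^ j * cnj (c * z) ^ k = (c ^ j * cnj c ^ k) * (z ^ j * cnj z ^ k)"
      by (simp add: power_mult_distrib)
    then show ?thesis
      unfolding G_def using c cjk by (simp add: norm_mult split: split_indicator)
  qed
  moreover have "G \<in> borel_measurable borel"
    unfolding G_def
    by (intro borel_measurable_scaleR borel_measurable_indicator borel_measurable_continuous_onI continuous_intros) auto
  moreover have "(*) c \<in> borel_measurable borel"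
    by (intro borel_measurable_continuous_onI continuous_intros)
  ultimately have "(LINT z|distr lborel borel ((*) c). G z) = (LINT z|lborel. - G z)"
    by (subst integral_distr) auto
  then have "(LINT z|lborel. G z) = - (LINT z|lborel. G z)"
    using distr_lborel_rotation[OF c] by simp
  then show ?thesis
    by (simp add: set_lebesgue_integral_def G_def)
qed

lemma disc_integral_monomial:
  assumes "0 \<le> s" "s \<le> 1"
  shows "disc_integral s (\<lambda>z. (1 - (cmod z)\<^sup>2) * (cmod z)\<^sup>2 ^ k) = radial_moment k (s\<^sup>2)"
  unfolding disc_integral_def using assms
  by (subst integral_radial_disc[where F = "\<lambda>t. (1 - t) * t ^ k"]) (simp_all add: integral_radial_moment)

lemma disc_integral_inverse_weight:
  assumes "0 \<le> s" "s < 1"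
  shows "disc_integral s (\<lambda>z. 1 / (1 - (cmod z)\<^sup>2)) = ln (1 / (1 - s\<^sup>2))"
  unfolding disc_integral_def using assms
  by (subst integral_radial_disc[where F = "\<lambda>t. 1 / (1 - t)"]) 
     (simp_all add: integral_inverse_weight power_less_one_iff)

text \<open>Parseval's identity: of the expanded double sum only the diagonal survives. Any bound
  \<open>n\<close> on the degree is allowed, so a polynomial and its cutoff can be summed over the
  same range.\<close>

lemma disc_integral_poly_square:
  assumes "0 \<le> s" "s \<le> 1" and n: "degree p \<le> n"
  shows "disc_integral s (\<lambda>z. (1 - (cmod z)\<^sup>2) * (cmod (poly p z))\<^sup>2)
    = (\<Sum>k\<le>n. (cmod (coeff p k))\<^sup>2 * radial_moment k (s\<^sup>2))"
proof -
  let ?w = "\<lambda>z. of_real (1 - (cmod z)\<^sup>2) :: complex"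
  define m where "m j k z = ?w z * (z ^ j * cnj z ^ k)" for j k z
  have int: "set_integrable lborel (ball 0 s) (m j k)" for j k
    unfolding m_def by (intro set_integrable_ball_continuous continuous_intros)
  have orth: "(LINT z:ball 0 s|lborel. m j k z) = 0" if "j \<noteq> k" for j k
    unfolding m_def using that by (rule integral_monomials_orthogonal)
  have expand: "of_real ((1 - (cmod z)\<^sup>2) * (cmod (poly p z))\<^sup>2)
      = (\<Sum>j\<le>n. \<Sum>k\<le>n. coeff p j * cnj (coeff p k) * m j k z)" for z
  proof -
    have "poly p z = (\<Sum>j\<le>n. coeff p j * z ^ j)"
      unfolding poly_altdef using n by (intro sum.mono_neutral_left) (auto simp: coeff_eq_0)
    then have "complex_of_real ((cmod (poly p z))\<^sup>2) = (\<Sum>j\<le>n. coeff p j * z ^ j) * cnj (\<Sum>k\<le>n. coeff p k * z ^ k)"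
      by (simp only: complex_norm_square)
    also have "\<dots> = (\<Sum>j\<le>n. \<Sum>k\<le>n. (coeff p j * z ^ j) * (cnj (coeff p k) * cnj z ^ k))"
      by (simp add: sum_product)
    finally show ?thesis
      by (simp add: m_def sum_distrib_left mult_ac)
  qed
  \<comment> \<open>The cross terms are complex, so the identity is proved in \<open>complex\<close>
    and read back through \<open>of_real\<close> at the end.\<close>
  have "of_real (LINT z:ball 0 s|lborel. (1 - (cmod z)\<^sup>2) * (cmod (poly p z))\<^sup>2)
      = (LINT z:ball 0 s|lborel. \<Sum>j\<le>n. \<Sum>k\<le>n. coeff p j * cnj (coeff p k) * m j k z)"
    by (simp only: set_integral_complex_of_real[symmetric] expand)
  also have "\<dots> = (\<Sum>j\<le>n. \<Sum>k\<le>n. coeff p j * cnj (coeff p k) * (LINT z:ball 0 s|lborel. m j k z))"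
  proof -
    define h where "h j k z = indicator (ball 0 s) z *\<^sub>R m j k z" for j k z
    have [simp]: "integrable lborel (h j k)" for j k
      using int[of j k] unfolding h_def[abs_def] set_integrable_def .
    have "indicator (ball 0 s) z *\<^sub>R (\<Sum>j\<le>n. \<Sum>k\<le>n. coeff p j * cnj (coeff p k) * m j k z)
      = (\<Sum>j\<le>n. \<Sum>k\<le>n. coeff p j * cnj (coeff p k) * h j k z)" for z
      by (simp only: h_def scaleR_sum_right mult_scaleR_right)
    then show ?thesis
      unfolding set_lebesgue_integral_def h_def[symmetric] by simp
  qed
  also have "\<dots> = (\<Sum>j\<le>n. coeff p j * cnj (coeff p j) * (LINT z:ball 0 s|lborel. m j j z))"
  proof (rule sum.cong)
    fix j assume "j \<in> {..n}"
    then show "(\<Sum>k\<le>n. coeff p j * cnj (coeff p k) * (LINT z:ball 0 s|lborel. m j k z))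
        = coeff p j * cnj (coeff p j) * (LINT z:ball 0 s|lborel. m j j z)"
      by (subst sum.remove[of _ j]) (auto intro!: sum.neutral simp: orth)
  qed simp
  also have "\<dots> = (\<Sum>j\<le>n. of_real ((cmod (coeff p j))\<^sup>2 * (pi * radial_moment j (s\<^sup>2))))"
  proof (rule sum.cong)
    fix j
    have "m j j z = of_real ((1 - (cmod z)\<^sup>2) * (cmod z)\<^sup>2 ^ j)" for z
    proof -
      have "z ^ j * cnj z ^ j = of_real ((cmod z)\<^sup>2 ^ j)"
        by (metis complex_norm_square of_real_power power_mult_distrib)
      then show ?thesis by (simp only: m_def of_real_mult)
    qed
    then have "(LINT z:ball 0 s|lborel. m j j z) = of_real (LINT z:ball 0 s|lborel. (1 - (cmod z)\<^sup>2) * (cmod z)\<^sup>2 ^ j)"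
      by (simp only: set_integral_complex_of_real)
    also have "\<dots> = of_real (pi * radial_moment j (s\<^sup>2))"
      using disc_integral_monomial[of s j] assms by (simp add: disc_integral_def field_simps)
    finally show "coeff p j * cnj (coeff p j) * (LINT z:ball 0 s|lborel. m j j z)
        = of_real ((cmod (coeff p j))\<^sup>2 * (pi * radial_moment j (s\<^sup>2)))"
      by (metis complex_norm_square of_real_mult)
  qed simp
  also have "\<dots> = of_real (\<Sum>j\<le>n. (cmod (coeff p j))\<^sup>2 * (pi * radial_moment j (s\<^sup>2)))"
    by simp
  finally have "(LINT z:ball 0 s|lborel. (1 - (cmod z)\<^sup>2) * (cmod (poly p z))\<^sup>2)
     = (\<Sum>j\<le>n. (cmod (coeff p j))\<^sup>2 * (pi * radial_moment j (s\<^sup>2)))"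
    by (simp only: of_real_eq_iff)
  then show ?thesis
    by (simp add: disc_integral_def sum_divide_distrib)
qed

section \<open>The quadratic and linear terms of the expanded \<open>Phi\<close>, and their
  dependence on the radius\<close>

definition sq_mass :: "real \<Rightarrow> complex poly \<Rightarrow> real" where
  "sq_mass s p = disc_integral s (\<lambda>z. (1 - (cmod z)\<^sup>2) * (cmod (poly p z))\<^sup>2)"

definition abs_mass :: "real \<Rightarrow> complex poly \<Rightarrow> real" where
  "abs_mass s p = disc_integral s (\<lambda>z. cmod (poly p z))"

text \<open>The integral of \<open>dA / (1 - \<bar>z\<bar>\<^sup>2)\<close> over \<open>ball 0 r\<close>, hence the normalising factor in the densities.\<close>

definition hyp_area :: "real \<Rightarrow> real" where
  "hyp_area r = ln (1 / (1 - r\<^sup>2))"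

lemma disc_integral_add:
  assumes "set_integrable lborel (ball 0 s) F" "set_integrable lborel (ball 0 s) G"
  shows "disc_integral s (\<lambda>z. F z + G z) = disc_integral s F + disc_integral s G"
  using assms by (simp add: disc_integral_def set_integral_add add_divide_distrib)

lemma disc_integral_diff:
  assumes "set_integrable lborel (ball 0 s) F" "set_integrable lborel (ball 0 s) G"
  shows "disc_integral s (\<lambda>z. F z - G z) = disc_integral s F - disc_integral s G"
  using assms by (simp add: disc_integral_def set_integral_diff diff_divide_distrib)

lemma disc_integral_mult: "disc_integral s (\<lambda>z. c * F z) = c * disc_integral s F"
  by (simp add: disc_integral_def)

lemma disc_integral_mono:
  assumes "set_integrable lborel (ball 0 s) F" "set_integrable lborel (ball 0 s) G"
    and "\<And>z. z \<in> ball 0 s \<Longrightarrow> F z \<le> G z"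
  shows "disc_integral s F \<le> disc_integral s G"
  unfolding disc_integral_def using assms by (intro divide_right_mono set_integral_mono) auto

lemma disc_integral_mono_radius:
  assumes "set_integrable lborel (ball 0 r) F" "s \<le> r" "\<And>z. z \<in> ball 0 r \<Longrightarrow> 0 \<le> F z"
  shows "disc_integral s F \<le> disc_integral r F"
proof -
  have "set_integrable lborel (ball 0 s) F"
    using assms by (auto intro: set_integrable_subset)
  then show ?thesis
    unfolding disc_integral_def set_lebesgue_integral_def set_integrable_def
    using assms
    by (intro divide_right_mono integral_mono)
       (auto simp: set_integrable_def split: split_indicator)
qed

lemma integrable_sq: "set_integrable lborel (ball 0 s) (\<lambda>z. (1 - (cmod z)\<^sup>2) * (cmod (poly p z))\<^sup>2)"
  by (intro set_integrable_ball_continuous continuous_intros)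

lemma integrable_abs: "set_integrable lborel (ball 0 s) (\<lambda>z. cmod (poly p z))"
  by (intro set_integrable_ball_continuous continuous_intros)

lemma weight_pos: "cmod z \<le> s \<Longrightarrow> s < 1 \<Longrightarrow> 0 < 1 - (cmod z)\<^sup>2"
  by (simp add: power_less_one_iff)

lemma integrable_inverse_weight: "s < 1 \<Longrightarrow> set_integrable lborel (ball (0::complex) s) (\<lambda>z. 1 / (1 - (cmod z)\<^sup>2))"
  using weight_pos by (intro set_integrable_ball_continuous continuous_intros) force+

lemma hyp_area_eq: "0 \<le> s \<Longrightarrow> s < 1 \<Longrightarrow> disc_integral s (\<lambda>z. 1 / (1 - (cmod z)\<^sup>2)) = hyp_area s"
  unfolding hyp_area_def by (rule disc_integral_inverse_weight)

lemma hyp_area_mono: "0 \<le> s \<Longrightarrow> s \<le> r \<Longrightarrow> r < 1 \<Longrightarrow> hyp_area s \<le> hyp_area r"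
  by (auto simp: hyp_area_def power_less_one_iff power_mono intro!: divide_left_mono mult_pos_pos)

lemma sq_mass_eq:
  assumes "0 \<le> s" "s \<le> 1" "degree p \<le> n"
  shows "sq_mass s p = (\<Sum>k\<le>n. (cmod (coeff p k))\<^sup>2 * radial_moment k (s\<^sup>2))"
  unfolding sq_mass_def using assms by (rule disc_integral_poly_square)

lemma sq_mass_mono:
  assumes "0 \<le> s" "s \<le> r" "r \<le> 1"
  shows "sq_mass s p \<le> sq_mass r p"
  unfolding sq_mass_def using assms
  by (intro disc_integral_mono_radius integrable_sq) (auto simp: abs_square_le_1 intro!: mult_nonneg_nonneg)

lemma sq_mass_nonneg: "0 \<le> s \<Longrightarrow> s \<le> 1 \<Longrightarrow> 0 \<le> sq_mass s p"
  by (auto simp: sq_mass_eq[OF _ _ order_refl] power_le_one intro!: sum_nonneg mult_nonneg_nonneg radial_moment_nonneg)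

lemma degree_poly_cutoff_le: "degree (poly_cutoff n p) \<le> degree p"
  by (rule degree_le) (simp add: coeff_poly_cutoff coeff_eq_0)

lemma poly_cutoff_in_Pol: "poly_cutoff n p \<in> Pol n"
proof (cases "poly_cutoff n p = 0")
  case False
  then have "coeff (poly_cutoff n p) (degree (poly_cutoff n p)) \<noteq> 0"
    by simp
  then have "degree (poly_cutoff n p) < n"
    unfolding coeff_poly_cutoff by (simp split: if_splits)
  then show ?thesis by (simp add: Pol_def)
qed (simp add: Pol_def)

lemma sq_mass_cutoff_le:
  assumes "0 \<le> s" "s \<le> 1"
  shows "sq_mass s (poly_cutoff n p) \<le> sq_mass s p"
  using assms degree_poly_cutoff_le[of n p]
  by (auto simp: sq_mass_eq[where n = "degree p"] coeff_poly_cutoff power_le_one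
      intro!: sum_mono mult_right_mono mult_nonneg_nonneg radial_moment_nonneg)

text \<open>Compared coefficientwise by Parseval. Below \<open>n\<close> the left side vanishes and
  the right side is nonnegative; from \<open>n\<close> on, \<open>radial_moment_decay\<close> places
  at least half of the monomial's mass between the two circles.\<close>

lemma sq_mass_tail_le:
  assumes x: "0 < x" "x \<le> 1 / 4" and n: "1 / x \<le> real n + 1"
  shows "sq_mass (sqrt (1 - x)) (p - poly_cutoff n p)
    \<le> 2 * (sq_mass (sqrt (1 - x)) p - sq_mass (sqrt (1 - 4 * x)) p)"
proof -
  let ?c = "\<lambda>k. (cmod (coeff p k))\<^sup>2" and ?u = "1 - x" and ?v = "1 - 4 * x"
  have deg: "degree (p - poly_cutoff n p) \<le> degree p"
    using degree_poly_cutoff_le by (intro degree_diff_le) auto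
  have "sq_mass (sqrt ?u) (p - poly_cutoff n p)
      = (\<Sum>k\<le>degree p. (cmod (coeff (p - poly_cutoff n p) k))\<^sup>2 * radial_moment k ?u)"
    using x deg by (subst sq_mass_eq) auto
  also have "\<dots> \<le> (\<Sum>k\<le>degree p. 2 * (?c k * radial_moment k ?u - ?c k * radial_moment k ?v))"
  proof (rule sum_mono)
    fix k
    show "(cmod (coeff (p - poly_cutoff n p) k))\<^sup>2 * radial_moment k ?u
        \<le> 2 * (?c k * radial_moment k ?u - ?c k * radial_moment k ?v)"
    proof (cases "k < n")
      case True
      then show ?thesis
        using x radial_moment_mono[of ?v ?u k] by (simp add: coeff_poly_cutoff mult_left_mono)
    next
      case False
      then have "radial_moment k ?v \<le> radial_moment k ?u / 2"
        using x n by (intro radial_moment_decay) auto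
      then have "?c k * radial_moment k ?u \<le> ?c k * (2 * (radial_moment k ?u - radial_moment k ?v))"
        by (intro mult_left_mono) auto
      then show ?thesis
        using False by (simp add: coeff_poly_cutoff algebra_simps)
    qed
  qed
  also have "\<dots> = 2 * (sq_mass (sqrt ?u) p - sq_mass (sqrt ?v) p)"
    using x by (simp add: sq_mass_eq[OF _ _ order_refl] sum_subtractf flip: sum_distrib_left)
  finally show ?thesis .
qed

lemma abs_mass_triangle: "abs_mass s p \<le> abs_mass s q + abs_mass s (p - q)"
  unfolding abs_mass_def disc_integral_add[OF integrable_abs integrable_abs, symmetric]
proof (intro disc_integral_mono integrable_abs set_integral_add)
  show "cmod (poly p z) \<le> cmod (poly q z) + cmod (poly (p - q) z)" for z
    using norm_triangle_ineq[of "poly q z" "poly (p - q) z"] by simp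
qed

text \<open>The inequality of arithmetic and geometric means, weighted by a free \<open>c\<close>
  and integrated over the annulus between \<open>s\<close> and \<open>r\<close>. The choice of
  \<open>c\<close> later balances mass against area; \<open>s = 0\<close> covers the whole
  disc.\<close>

lemma abs_mass_increment_le:
  assumes "0 \<le> s" "s \<le> r" "r < 1" "0 < c"
  shows "2 * (abs_mass r p - abs_mass s p) \<le> c * (sq_mass r p - sq_mass s p) + (hyp_area r - hyp_area s) / c"
proof -
  \<comment> \<open>\<open>F\<close> is a perfect square divided by a positive weight, so its integral grows with the disc.\<close>
  define F where "F z = (c * ((1 - (cmod z)\<^sup>2) * (cmod (poly p z))\<^sup>2) + (1 / c) * (1 / (1 - (cmod z)\<^sup>2)))
     - 2 * cmod (poly p z)" for z
  have int: "set_integrable lborel (ball 0 t) (\<lambda>z. c * ((1 - (cmod z)\<^sup>2) * (cmod (poly p z))\<^sup>2))"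
    "set_integrable lborel (ball 0 t) (\<lambda>z. 2 * cmod (poly p z))"
    "set_integrable lborel (ball (0::complex) t) (\<lambda>z. (1 / c) * (1 / (1 - (cmod z)\<^sup>2)))"
    "set_integrable lborel (ball 0 t) F" if "t < 1" for t
    unfolding F_def
    by (intro set_integral_add set_integral_diff set_integrable_mult_right integrable_sq integrable_abs
          integrable_inverse_weight that)+
  have eq: "disc_integral t F = c * sq_mass t p + (1 / c) * hyp_area t - 2 * abs_mass t p" if "0 \<le> t" "t < 1" for t
    unfolding F_def using that
    by (subst disc_integral_diff disc_integral_add,
        (intro int set_integral_add; simp)+)+
       (simp only: disc_integral_mult hyp_area_eq sq_mass_def abs_mass_def)
  have "0 \<le> F z" if "z \<in> ball 0 r" for z
  proof -
    define w where "w = 1 - (cmod z)\<^sup>2"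
    have "0 < w" using that \<open>r < 1\<close> weight_pos[of z r] by (simp add: w_def)
    have "F z = (c * w * cmod (poly p z) - 1)\<^sup>2 / (c * w)"
      using \<open>0 < w\<close> \<open>0 < c\<close> unfolding F_def w_def[symmetric]
      by (simp add: power2_eq_square field_simps)
    then show ?thesis using \<open>0 < w\<close> \<open>0 < c\<close> by simp
  qed
  then have "disc_integral s F \<le> disc_integral r F"
    using assms int by (intro disc_integral_mono_radius) auto
  then show ?thesis
    using assms by (simp add: eq algebra_simps diff_divide_distrib)
qed

text \<open>The unnormalised densities: \<open>t = r\<close> gives \<open>rho_H_at\<close> and \<open>t = 1\<close> gives \<open>rho_H_star_at\<close>.\<close>

definition excess :: "real \<Rightarrow> real \<Rightarrow> complex poly \<Rightarrow> real" where
  "excess t r p = sq_mass t p - 2 * abs_mass r p + hyp_area r"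

text \<open>Expanding the square and dividing by the weight leaves the quadratic term on all of
  \<open>ball 0 t\<close>, and the linear and constant terms on \<open>ball 0 r\<close>
  only.\<close>

lemma Phi_integral:
  assumes "0 \<le> r" "r < 1" "r \<le> t" "t \<le> 1"
  shows "disc_integral t (\<lambda>z. Phi (poly p) z r / (1 - (cmod z)\<^sup>2)) = excess t r p"
proof -
  let ?F = "\<lambda>z. (1 - (cmod z)\<^sup>2) * (cmod (poly p z))\<^sup>2"
  let ?G = "\<lambda>z. 1 / (1 - (cmod z)\<^sup>2) - 2 * cmod (poly p z)"
  have G: "set_integrable lborel (ball 0 r) ?G"
    using assms by (intro set_integral_diff set_integrable_mult_right integrable_abs integrable_inverse_weight)
  have ball: "ball (0::complex) t \<inter> ball 0 r = ball 0 r" using assms by auto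
  \<comment> \<open>For \<open>t = 1\<close> the function \<open>?G\<close> is not integrable on the
    whole disc, so the indicator has to stay attached to it.\<close>
  have restrict: "indicator (ball 0 t) z *\<^sub>R (indicator (ball 0 r) z * ?G z) = indicator (ball 0 r) z *\<^sub>R ?G z" for z
    using assms by (auto split: split_indicator)
  have "Phi (poly p) z r / (1 - (cmod z)\<^sup>2) = ?F z + indicator (ball 0 r) z * ?G z" if "z \<in> ball 0 t" for z
  proof -
    have "(cmod z)\<^sup>2 < 1" using that assms by (simp add: power_less_one_iff)
    then have "0 < 1 - (cmod z)\<^sup>2" by simp
    then show ?thesis
      by (auto simp: Phi_def power2_eq_square field_simps split: split_indicator)
  qed
  then have "disc_integral t (\<lambda>z. Phi (poly p) z r / (1 - (cmod z)\<^sup>2))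
      = disc_integral t (\<lambda>z. ?F z + indicator (ball 0 r) z * ?G z)"
    unfolding disc_integral_def by (intro arg_cong[of _ _ "\<lambda>x. x / pi"] set_lebesgue_integral_cong) auto
  also have "\<dots> = sq_mass t p + disc_integral t (\<lambda>z. indicator (ball 0 r) z * ?G z)"
    unfolding sq_mass_def using G
    by (intro disc_integral_add integrable_sq) (simp only: set_integrable_def restrict)
  also have "disc_integral t (\<lambda>z. indicator (ball 0 r) z * ?G z) = disc_integral r ?G"
    by (simp only: disc_integral_def set_lebesgue_integral_def restrict)
  also have "\<dots> = hyp_area r - 2 * abs_mass r p"
    using assms
    by (subst disc_integral_diff)
       (auto intro!: integrable_inverse_weight integrable_abs set_integrable_mult_right
         simp: disc_integral_mult hyp_area_eq abs_mass_def)
  finally show ?thesis by (simp add: excess_def)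
qed

lemma excess_nonneg:
  assumes "0 \<le> r" "r < 1" "r \<le> t" "t \<le> 1"
  shows "0 \<le> excess t r p"
  unfolding Phi_integral[OF assms, symmetric] disc_integral_def set_lebesgue_integral_def
proof (intro divide_nonneg_pos Bochner_Integration.integral_nonneg pi_gt_zero)
  show "0 \<le> indicator (ball 0 t) z *\<^sub>R (Phi (poly p) z r / (1 - (cmod z)\<^sup>2))" for z
    using assms by (auto simp: Phi_def abs_square_le_1 split: split_indicator)
qed

lemma rho_H_at_eq: "0 < r \<Longrightarrow> r < 1 \<Longrightarrow> rho_H_at r p = excess r r p / hyp_area r"
  using Phi_integral[of r r p] by (simp add: rho_H_at_def disc_integral_def hyp_area_def)

lemma rho_H_star_at_eq: "0 < r \<Longrightarrow> r < 1 \<Longrightarrow> rho_H_star_at r p = excess 1 r p / hyp_area r"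
  using Phi_integral[of r 1 p] by (simp add: rho_H_star_at_def disc_integral_def hyp_area_def)

lemma excess_0 [simp]: "excess t r 0 = hyp_area r"
  by (simp add: excess_def sq_mass_def abs_mass_def disc_integral_def)

lemma zero_radius [simp]: "sq_mass 0 p = 0" "abs_mass 0 p = 0" "hyp_area 0 = 0"
  by (simp_all add: sq_mass_def abs_mass_def hyp_area_def disc_integral_def set_lebesgue_integral_def)

subsection \<open>Cutting off the degree\<close>

text \<open>Pigeonhole: the \<open>q\<close> increments telescope, so one is at most their average.
  Every \<open>j\<close> in the range is positive, hence \<open>j - 1\<close> is not
  truncated.\<close>

lemma exists_small_increment:
  fixes a :: "nat \<Rightarrow> real"
  assumes "0 < q" "q \<le> m"
  shows "\<exists>j\<in>{m - q<..m}. a j - a (j - 1) \<le> (a m - a (m - q)) / real q"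
proof (rule ccontr)
  assume "\<not> ?thesis"
  then have *: "(a m - a (m - q)) / real q < a j - a (j - 1)" if "j \<in> {m - q<..m}" for j
    using that by force
  have "(\<Sum>j\<in>{m - q<..m}. (a m - a (m - q)) / real q) < (\<Sum>j\<in>{m - q<..m}. a j - a (j - 1))"
    using assms * by (intro sum_strict_mono) auto
  also have "(\<Sum>j\<in>{m - q<..m}. a j - a (j - 1)) = (\<Sum>j=Suc (m - q)..m. a j - a (j - 1))"
    by (simp add: atLeastSucAtMost_greaterThanAtMost)
  also have "\<dots> = a m - a (m - q)"
    by (rule sum_telescope'') simp
  finally show False using assms by simp
qed

lemma hyp_area_dyadic: "hyp_area (sqrt (1 - 1 / 4 ^ j)) = real j * ln 4"
  by (simp add: hyp_area_def ln_realpow)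

text \<open>The hypothesis says that \<open>p\<close> is no worse than the zero polynomial. Taking
  \<open>c = 1 / 2\<close> in \<open>abs_mass_increment_le\<close> lets half of the mass be absorbed
  on the left.\<close>

lemma excess_le_hyp_area_imp_sq_mass_le:
  assumes "0 < r" "r < 1" "r \<le> t" "t \<le> 1" and "excess t r p \<le> hyp_area r"
  shows "sq_mass t p \<le> 4 * hyp_area r"
proof -
  have "sq_mass t p \<le> 2 * abs_mass r p"
    using assms by (simp add: excess_def)
  also have "2 * abs_mass r p \<le> 1 / 2 * sq_mass r p + 2 * hyp_area r"
    using abs_mass_increment_le[of 0 r "1 / 2" p] assms
    by simp
  finally have "sq_mass t p \<le> 1 / 2 * sq_mass r p + 2 * hyp_area r" .
  moreover have "sq_mass r p \<le> sq_mass t p"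
    using assms by (intro sq_mass_mono) auto
  ultimately show ?thesis by linarith
qed

text \<open>The parameter \<open>\<sigma>\<close> is the identity for \<open>rho_H\<close> and constantly \<open>1\<close> for \<open>rho_H_star\<close>.\<close>

lemma excess_transfer:
  fixes \<sigma> :: "real \<Rightarrow> real"
  assumes \<sigma>: "\<And>s. 0 < s \<Longrightarrow> s < 1 \<Longrightarrow> s \<le> \<sigma> s \<and> \<sigma> s \<le> 1" "\<And>s s'. s \<le> s' \<Longrightarrow> \<sigma> s \<le> \<sigma> s'"
    and r: "0 < r" "r < 1" and T: "hyp_area r = T ^ 4" "3 \<le> T"
    and p: "excess (\<sigma> r) r p \<le> hyp_area r"
  shows "\<exists>R. 0 < R \<and> R \<le> r \<and> hyp_area r - 4 * T\<^sup>2 \<le> hyp_area R \<and>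
    (\<exists>g\<in>Pol (deg_bound R). excess (\<sigma> R) R g \<le> excess (\<sigma> r) r p + 17 * T ^ 3)"
proof -
  \<comment> \<open>\<open>q\<close> is the number of annuli searched, of order
    \<open>T\<^sup>2\<close>. As \<open>hyp_area (rad j)\<close> is \<open>j * ln 4\<close>,
    \<open>m\<close> is the last index with \<open>rad m \<le> r\<close>.\<close>
  define q where "q = nat \<lceil>T\<^sup>2\<rceil>"
  define m where "m = nat \<lfloor>T ^ 4 / ln 4\<rfloor>"
  define rad where "rad j = sqrt (1 - 1 / 4 ^ j)" for j :: nat
  have T2: "9 \<le> T\<^sup>2" using power_mono[of 3 T 2] T by simp
  have T4: "T ^ 4 = T\<^sup>2 * T\<^sup>2" by (simp flip: power_add)
  have ln4: "1 \<le> ln (4::real)" "ln (4::real) \<le> 2"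
  proof -
    have "ln (4::real) = 2 * ln 2" using ln_realpow[of 2 2] by simp
    then show "ln (4::real) \<le> 2" using ln_add_one_self_le_self[of 1] by simp
    have "exp 1 \<le> (4::real)" using exp_le by simp
    then show "1 \<le> ln (4::real)" by (simp add: ln_ge_iff)
  qed
  have q: "T\<^sup>2 \<le> real q" "real q \<le> 2 * T\<^sup>2"
    unfolding q_def using T2 by linarith+
  have m: "real m * ln 4 \<le> T ^ 4" "T ^ 4 < (real m + 1) * ln 4"
  proof -
    have "0 \<le> T ^ 4 / ln 4" using ln4 T4 by simp
    then have "real m \<le> T ^ 4 / ln 4" "T ^ 4 / ln 4 < real m + 1"
      unfolding m_def by linarith+
    then show "real m * ln 4 \<le> T ^ 4" "T ^ 4 < (real m + 1) * ln 4"
      using ln4 by (simp_all add: field_simps)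
  qed
  \<comment> \<open>Since \<open>T \<ge> 3\<close>, the index \<open>m\<close>, of order
    \<open>T ^ 4\<close>, dominates \<open>q\<close>, of order \<open>T\<^sup>2\<close>, so
    \<open>m - q\<close> is not truncated.\<close>
  have qm: "0 < q" "q \<le> m"
  proof -
    show "0 < q" using q T2 by (cases q) auto
    have "(real m + 1) * ln 4 \<le> (real m + 1) * 2" using ln4 by (intro mult_left_mono) auto
    moreover have "9 * T\<^sup>2 \<le> T ^ 4" unfolding T4 using T2 by (intro mult_right_mono) auto
    moreover have "(real m + 1) * 2 = 2 * real m + 2" by simp
    ultimately have "9 * T\<^sup>2 < 2 * real m + 2" using m(2) by linarith
    then have "real q \<le> real m" using q(2) T2 by linarith
    then show "q \<le> m" by simp
  qed
  have area_rad: "hyp_area (rad j) = real j * ln 4" for j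
    unfolding rad_def by (rule hyp_area_dyadic)
  have rad: "0 \<le> rad j" "rad j < 1" for j
    by (simp_all add: rad_def)
  have rad_mono: "rad i \<le> rad j" if "i \<le> j" for i j
    using that by (simp add: rad_def frac_le)
  have rad_m: "rad m \<le> r"
  proof (rule ccontr)
    assume "\<not> rad m \<le> r"
    then have "r < rad m" by simp
    then have "r\<^sup>2 < (rad m)\<^sup>2" using r by (intro power_strict_mono) auto
    moreover have "(rad m)\<^sup>2 < 1" using rad by (simp add: power_less_one_iff)
    ultimately have "hyp_area r < hyp_area (rad m)"
      by (auto simp: hyp_area_def intro!: divide_strict_left_mono mult_pos_pos)
    then show False using m T area_rad by simp
  qed
  have mass: "sq_mass (\<sigma> r) p \<le> 4 * T ^ 4"
    using excess_le_hyp_area_imp_sq_mass_le[of r "\<sigma> r" p] r \<sigma>(1)[of r] p T by simp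
  \<comment> \<open>Total mass at most \<open>4 * T ^ 4\<close> spread over \<open>q\<close> annuli
    leaves one with mass at most \<open>4 * T\<^sup>2\<close>.\<close>
  obtain j where j: "m - q < j" "j \<le> m"
    and "sq_mass (rad j) p - sq_mass (rad (j - 1)) p \<le> (sq_mass (rad m) p - sq_mass (rad (m - q)) p) / real q"
    using exists_small_increment[OF qm, of "\<lambda>j. sq_mass (rad j) p"] by auto
  note this(3)
  also have "sq_mass (rad m) p - sq_mass (rad (m - q)) p \<le> 4 * T ^ 4"
  proof -
    have "sq_mass (rad m) p \<le> sq_mass r p" using rad rad_m r by (intro sq_mass_mono) auto
    also have "\<dots> \<le> sq_mass (\<sigma> r) p" using r \<sigma>(1)[of r] by (intro sq_mass_mono) auto
    finally show ?thesis using mass sq_mass_nonneg[of "rad (m - q)" p] rad[of "m - q"] by simp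
  qed
  also have "4 * T ^ 4 / real q \<le> 4 * T\<^sup>2"
  proof -
    have "4 * T ^ 4 / real q \<le> 4 * T ^ 4 / T\<^sup>2"
      using q T2 by (intro divide_left_mono mult_pos_pos) auto
    also have "\<dots> = 4 * T\<^sup>2"
      using T by (simp add: power_numeral_reduce)
    finally show ?thesis .
  qed
  finally have shell: "sq_mass (rad j) p - sq_mass (rad (j - 1)) p \<le> 4 * T\<^sup>2"
    by (simp add: divide_right_mono)
  define R where "R = rad j"
  define x where "x = 1 / (4::real) ^ j"
  have "1 \<le> j" using j by simp
  then have x: "0 < x" "x \<le> 1 / 4"
    using power_increasing[of 1 j "4::real"] by (simp_all add: x_def frac_le)
  have R_x: "R = sqrt (1 - x)" by (simp add: R_def rad_def x_def)
  \<comment> \<open>Decreasing the index by one multiplies \<open>x\<close> by 4, which matches the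
    pair of radii in \<open>sq_mass_tail_le\<close>.\<close>
  have pred_x: "rad (j - 1) = sqrt (1 - 4 * x)"
    using \<open>1 \<le> j\<close> by (cases j) (simp_all add: rad_def x_def)
  have R: "0 < R" "R < 1" "R \<le> r"
    using x R_x rad_mono[OF j(2)] rad_m by (auto simp: R_def)
  have area_R: "hyp_area r - 4 * T\<^sup>2 \<le> hyp_area R"
  proof -
    have "real m + 1 - real j \<le> real q" using j by linarith
    then have "(real m + 1 - real j) * ln 4 \<le> real q * ln 4" using ln4 by (intro mult_right_mono) auto
    also have "\<dots> \<le> (2 * T\<^sup>2) * 2" using q ln4 by (intro mult_mono) auto
    finally show ?thesis using m T by (simp add: R_def area_rad algebra_simps)
  qed
  have area_R_le: "hyp_area R \<le> T ^ 4" using hyp_area_mono[of R r] R r T by simp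
  define n where "n = deg_bound R"
  \<comment> \<open>The degree bound is the ceiling of \<open>1 / x - 1\<close>, exactly the
    threshold that \<open>sq_mass_tail_le\<close> requires.\<close>
  have "R\<^sup>2 / (1 - R\<^sup>2) = 1 / x - 1" using x by (simp add: R_x field_simps)
  then have n: "1 / x \<le> real n + 1"
    unfolding n_def deg_bound_def by linarith
  define g where "g = poly_cutoff n p"
  have tail: "sq_mass R (p - g) \<le> 8 * T\<^sup>2"
  proof -
    have "sq_mass R (p - g) \<le> 2 * (sq_mass (rad j) p - sq_mass (rad (j - 1)) p)"
      using sq_mass_tail_le[OF x n, of p] by (simp only: g_def R_x pred_x flip: R_def)
    also have "\<dots> \<le> 2 * (4 * T\<^sup>2)"
      using shell by (rule mult_left_mono) simp
    finally show ?thesis by simp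
  qed
  \<comment> \<open>With tail mass of order \<open>T\<^sup>2\<close> and area of order
    \<open>T ^ 4\<close>, \<open>c = T\<close> makes both terms of order
    \<open>T ^ 3\<close>.\<close>
  have "2 * abs_mass R (p - g) \<le> T * sq_mass R (p - g) + hyp_area R / T"
    using abs_mass_increment_le[of 0 R T "p - g"] R T
    by simp
  also have "\<dots> \<le> T * (8 * T\<^sup>2) + T ^ 4 / T"
    using tail area_R_le T by (intro add_mono mult_left_mono divide_right_mono) auto
  also have "\<dots> = 9 * T ^ 3" using T by (simp add: power_numeral_reduce)
  finally have A_tail: "2 * abs_mass R (p - g) \<le> 9 * T ^ 3" .
  \<comment> \<open>The roles are reversed here: mass of order \<open>T ^ 4\<close> and area of
    order \<open>T\<^sup>2\<close> call for \<open>c = 1 / T\<close>.\<close>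
  have "2 * (abs_mass r p - abs_mass R p) \<le> (1 / T) * (sq_mass r p - sq_mass R p) + (hyp_area r - hyp_area R) / (1 / T)"
    using R r T by (intro abs_mass_increment_le) auto
  also have "\<dots> \<le> (1 / T) * (4 * T ^ 4) + (4 * T\<^sup>2) / (1 / T)"
  proof -
    have "sq_mass r p \<le> sq_mass (\<sigma> r) p" using r \<sigma>(1)[of r] by (intro sq_mass_mono) auto
    then have "sq_mass r p - sq_mass R p \<le> 4 * T ^ 4"
      using mass sq_mass_nonneg[of R p] R by simp
    then show ?thesis using area_R T by (intro add_mono mult_left_mono divide_right_mono) auto
  qed
  also have "\<dots> = 8 * T ^ 3" using T by (simp add: power_numeral_reduce)
  finally have A_ring: "2 * (abs_mass r p - abs_mass R p) \<le> 8 * T ^ 3" .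
  \<comment> \<open>Neither cutoff nor smaller radius increases the quadratic term, and the area
    term does not grow either. Only the linear term loses, \<open>9 * T ^ 3\<close> from the tail
    and \<open>8 * T ^ 3\<close> from the annulus.\<close>
  have "sq_mass (\<sigma> R) g \<le> sq_mass (\<sigma> R) p"
    unfolding g_def using R \<sigma>(1)[of R] by (intro sq_mass_cutoff_le) auto
  also have "\<dots> \<le> sq_mass (\<sigma> r) p"
    using R r \<sigma>(1)[of R] \<sigma>(1)[of r] \<sigma>(2)[of R r] by (intro sq_mass_mono) auto
  finally have "excess (\<sigma> R) R g \<le> excess (\<sigma> r) r p + 17 * T ^ 3"
    using A_tail A_ring[unfolded right_diff_distrib] abs_mass_triangle[of R p g] area_R_le T(1)
    unfolding excess_def by linarith
  moreover have "g \<in> Pol (deg_bound R)" unfolding g_def n_def by (rule poly_cutoff_in_Pol)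
  ultimately show ?thesis using R area_R by blast
qed

section \<open>Normalisation and passage to the lower limit\<close>

lemma filterlim_hyp_area: "filterlim hyp_area at_top (at_left 1)"
  unfolding hyp_area_def by real_asymp

text \<open>Dividing \<open>excess_transfer\<close> by the area leaves an error of order
  \<open>1 / T\<close>. The new radius depends on \<open>r\<close> and \<open>p\<close>, but it
  stays beyond the prescribed \<open>b\<close> because its area is close to that of
  \<open>r\<close>.\<close>

lemma density_transfer:
  fixes \<sigma> :: "real \<Rightarrow> real"
  assumes \<sigma>: "\<And>s. 0 < s \<Longrightarrow> s < 1 \<Longrightarrow> s \<le> \<sigma> s \<and> \<sigma> s \<le> 1" "\<And>s s'. s \<le> s' \<Longrightarrow> \<sigma> s \<le> \<sigma> s'"
    and b: "b < 1" and e: "0 < e"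
  shows "\<forall>\<^sub>F r in at_left 1. \<forall>p. \<exists>R. b < R \<and> 0 < R \<and> R < 1 \<and>
    (\<exists>g\<in>Pol (deg_bound R). excess (\<sigma> R) R g / hyp_area R \<le> excess (\<sigma> r) r p / hyp_area r + e)"
proof -
  define T where "T r = sqrt (sqrt (hyp_area r))" for r
  define B where "B = max 0 b"
  \<comment> \<open>The relative error after division by the reduced area, with the old density
    bounded by 1.\<close>
  define err where "err T = (4 * T\<^sup>2 + 17 * T ^ 3) / (T ^ 4 - 4 * T\<^sup>2)" for T :: real
  have B: "0 \<le> B" "B < 1" "b \<le> B" using b by (auto simp: B_def)
  have limT: "filterlim T at_top (at_left 1)"
    unfolding T_def by (intro filterlim_compose[OF sqrt_at_top] filterlim_hyp_area)
  have "\<forall>\<^sub>F T in at_top. 3 \<le> T \<and> hyp_area B < T ^ 4 - 4 * T\<^sup>2 \<and> err T < e"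
  proof (intro eventually_conj)
    show "\<forall>\<^sub>F T::real in at_top. 3 \<le> T" by (rule eventually_ge_at_top)
    have "filterlim (\<lambda>T::real. T ^ 4 - 4 * T\<^sup>2) at_top at_top" by real_asymp
    then show "\<forall>\<^sub>F T in at_top. hyp_area B < T ^ 4 - 4 * T\<^sup>2"
      by (simp add: filterlim_at_top_dense)
    have "(err \<longlongrightarrow> 0) at_top" unfolding err_def by real_asymp
    then show "\<forall>\<^sub>F T in at_top. err T < e" using e by (rule order_tendstoD)
  qed
  then have "\<forall>\<^sub>F r in at_left 1. 3 \<le> T r \<and> hyp_area B < T r ^ 4 - 4 * (T r)\<^sup>2 \<and> err (T r) < e"
    using limT by (rule eventually_compose_filterlim)
  moreover have "\<forall>\<^sub>F r in at_left (1::real). 0 < r \<and> r < 1"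
    using eventually_at_left_real[of 0 1] by simp
  moreover have "\<forall>\<^sub>F r in at_left 1. 0 < hyp_area r"
    using filterlim_hyp_area by (simp add: filterlim_at_top_dense)
  ultimately show ?thesis
  proof eventually_elim
    case (elim r)
    have T4: "hyp_area r = T r ^ 4"
    proof -
      have "T r ^ 4 = ((T r)\<^sup>2)\<^sup>2" by (simp flip: power_mult)
      then show ?thesis using elim by (simp add: T_def)
    qed
    have near: "b < R" if "0 < R" "R < 1" "hyp_area r - 4 * (T r)\<^sup>2 \<le> hyp_area R" for R
    proof (rule ccontr)
      assume "\<not> b < R"
      then have "hyp_area R \<le> hyp_area B" using B that by (intro hyp_area_mono) auto
      then show False using elim that T4 by linarith
    qed
    have area: "0 < T r ^ 4 - 4 * (T r)\<^sup>2"
    proof -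
      have "0 \<le> hyp_area B" using hyp_area_mono[of 0 B] B by simp
      then show ?thesis using elim by linarith
    qed
    show ?case
    proof
      fix p
      show "\<exists>R. b < R \<and> 0 < R \<and> R < 1 \<and>
          (\<exists>g\<in>Pol (deg_bound R). excess (\<sigma> R) R g / hyp_area R \<le> excess (\<sigma> r) r p / hyp_area r + e)"
      proof (cases "excess (\<sigma> r) r p \<le> hyp_area r")
        case True
        define \<rho> where "\<rho> = excess (\<sigma> r) r p / hyp_area r"
        have \<rho>: "0 \<le> \<rho>" "\<rho> \<le> 1" "excess (\<sigma> r) r p = \<rho> * T r ^ 4"
          using True elim excess_nonneg[of r "\<sigma> r" p] \<sigma>(1)[of r] by (auto simp: \<rho>_def T4)
        obtain R g where R: "0 < R" "R \<le> r" "hyp_area r - 4 * (T r)\<^sup>2 \<le> hyp_area R"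
          and g: "g \<in> Pol (deg_bound R)" "excess (\<sigma> R) R g \<le> excess (\<sigma> r) r p + 17 * T r ^ 3"
          using excess_transfer[of \<sigma> r "T r" p, OF \<sigma>] elim T4 True by auto
        have "excess (\<sigma> R) R g / hyp_area R \<le> (\<rho> * T r ^ 4 + 17 * T r ^ 3) / (T r ^ 4 - 4 * (T r)\<^sup>2)"
          using g R \<rho> T4 area elim by (intro frac_le) auto
        also have "\<dots> = \<rho> + (4 * (T r)\<^sup>2 * \<rho> + 17 * T r ^ 3) / (T r ^ 4 - 4 * (T r)\<^sup>2)"
          using area by (simp add: field_simps)
        also have "\<dots> \<le> \<rho> + err (T r)"
          unfolding err_def using area \<rho>
          by (intro add_left_mono divide_right_mono add_right_mono mult_left_le) auto
        finally show ?thesis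
          using elim R g near[of R] unfolding \<rho>_def[symmetric] by (intro exI[of _ R]) force
      next
        case False
        \<comment> \<open>A polynomial worse than zero is replaced by zero at the same radius, where
          the density is 1; \<open>Pol\<close> contains zero for every bound.\<close>
        have "b < r" using near[of r] elim by simp
        from False have "1 < excess (\<sigma> r) r p / hyp_area r" using elim by (simp add: field_simps)
        moreover have "excess (\<sigma> r) r 0 / hyp_area r = 1" using elim by simp
        ultimately have le: "excess (\<sigma> r) r 0 / hyp_area r \<le> excess (\<sigma> r) r p / hyp_area r + e"
          using e by linarith
        have "0 \<in> Pol (deg_bound r)" by (simp add: Pol_def)
        then show ?thesis using \<open>b < r\<close> elim le by (intro exI[of _ r] conjI bexI[of _ 0]) simp_all
      qed
    qed
  qed
qed

text \<open>One inequality is inclusion of the index sets. For the other, two reals are put above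
  \<open>y\<close>: the gap between them pays for the error in \<open>density_transfer\<close>, and
  the gap below \<open>y1\<close> keeps the inequality strict after the infimum.\<close>

lemma Liminf_density_eq:
  fixes \<sigma> :: "real \<Rightarrow> real" and \<rho> :: "real \<Rightarrow> complex poly \<Rightarrow> real"
  assumes \<sigma>: "\<And>s. 0 < s \<Longrightarrow> s < 1 \<Longrightarrow> s \<le> \<sigma> s \<and> \<sigma> s \<le> 1" "\<And>s s'. s \<le> s' \<Longrightarrow> \<sigma> s \<le> \<sigma> s'"
    and \<rho>: "\<And>r p. 0 < r \<Longrightarrow> r < 1 \<Longrightarrow> \<rho> r p = excess (\<sigma> r) r p / hyp_area r"
  shows "Liminf (at_left 1) (\<lambda>r. INF p\<in>UNIV. ereal (\<rho> r p))
    = Liminf (at_left 1) (\<lambda>r. INF p\<in>Pol (deg_bound r). ereal (\<rho> r p))"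
    (is "?L = ?R")
proof (rule antisym)
  show "?L \<le> ?R"
    by (intro Liminf_mono always_eventually allI INF_superset_mono) auto
  show "?R \<le> ?L"
    unfolding le_Liminf_iff
  proof (intro allI impI)
    fix y assume "y < ?R"
    then obtain y1 where y1: "y < ereal y1" "ereal y1 < ?R"
      using ereal_dense2 by blast
    then obtain y2 where y2: "ereal y1 < ereal y2" "ereal y2 < ?R"
      using ereal_dense2 by blast
    have "\<forall>\<^sub>F R in at_left 1. ereal y2 < (INF p\<in>Pol (deg_bound R). ereal (\<rho> R p))"
      using y2(2) by (rule less_LiminfD)
    \<comment> \<open>Beyond \<open>b\<close> the restricted infimum exceeds \<open>y2\<close> at
      every radius, so it does not matter which \<open>R\<close> the transfer selects.\<close>
    then obtain b where b: "b < 1" "\<And>R. b < R \<Longrightarrow> R < 1 \<Longrightarrow> ereal y2 < (INF p\<in>Pol (deg_bound R). ereal (\<rho> R p))"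
      unfolding eventually_at_left_field by blast
    have "\<forall>\<^sub>F r in at_left (1::real). 0 < r \<and> r < 1"
      using eventually_at_left_real[of 0 1] by simp
    moreover have "\<forall>\<^sub>F r in at_left 1. \<forall>p. \<exists>R. b < R \<and> 0 < R \<and> R < 1 \<and>
      (\<exists>g\<in>Pol (deg_bound R). excess (\<sigma> R) R g / hyp_area R \<le> excess (\<sigma> r) r p / hyp_area r + (y2 - y1))"
      using \<sigma> b(1) y2(1) by (intro density_transfer) auto
    ultimately show "\<forall>\<^sub>F r in at_left 1. y < (INF p\<in>UNIV. ereal (\<rho> r p))"
    proof eventually_elim
      case (elim r)
      have "ereal y1 \<le> ereal (\<rho> r p)" for p
      proof -
        obtain R g where R: "b < R" "0 < R" "R < 1" "g \<in> Pol (deg_bound R)"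
          and le: "excess (\<sigma> R) R g / hyp_area R \<le> excess (\<sigma> r) r p / hyp_area r + (y2 - y1)"
          using elim by blast
        have "ereal y2 < ereal (\<rho> R g)"
          using b(2)[OF R(1,3)] R(4) by (rule less_INF_D)
        then show ?thesis using le R elim by (simp add: \<rho>)
      qed
      then have "ereal y1 \<le> (INF p\<in>UNIV. ereal (\<rho> r p))"
        by (intro INF_greatest)
      with y1(1) show ?case by (rule less_le_trans)
    qed
  qed
qed

theorem corollary1p3:
  shows "rho_H = Liminf (at_left 1) (\<lambda>r. INF f\<in>Pol (deg_bound r). ereal (rho_H_at r f))
       \<and> rho_H_star = Liminf (at_left 1) (\<lambda>r. INF f\<in>Pol (deg_bound r). ereal (rho_H_star_at r f))"
  unfolding rho_H_def rho_H_star_def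
proof
  show "Liminf (at_left 1) (\<lambda>r. INF f\<in>UNIV. ereal (rho_H_at r f))
      = Liminf (at_left 1) (\<lambda>r. INF f\<in>Pol (deg_bound r). ereal (rho_H_at r f))"
    by (rule Liminf_density_eq[where \<sigma> = "\<lambda>s. s"]) (auto simp: rho_H_at_eq)
  show "Liminf (at_left 1) (\<lambda>r. INF f\<in>UNIV. ereal (rho_H_star_at r f))
      = Liminf (at_left 1) (\<lambda>r. INF f\<in>Pol (deg_bound r). ereal (rho_H_star_at r f))"
    by (rule Liminf_density_eq[where \<sigma> = "\<lambda>s. 1"]) (auto simp: rho_H_star_at_eq)
qed

end
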